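(* Let $n \geqslant 30$ and $k \geqslant 2$ be integers with $k \leqslant \sqrt{n/\ln n}$. Let $H=(V,E)$ be an $n$-uniform hypergraph in which every edge intersects at most $D$ other edges, where $$D \leqslant \frac{5}{3e^{26}}\left(\frac{n}{k\ln n} \right)^{1/2}\frac{2^{n-1}}{\binom{n-1}{k-1}} - 1.$$ Then $H$ has property $B_k$.
   Context: A hypergraph is a pair $H=(V,E)$ with $V$ a finite vertex set and $E$ a family of subsets of $V$; it is $n$-uniform if every edge has exactly $n$ vertices. A hypergraph has property $B_k$ if there is a 2-coloring of its vertices such that every edge contains at least $k$ vertices of each color. *)

theory Defs
  imports Complex_Main
begin

definition hypergraph :: "'v set \<Rightarrow> 'v set set \<Rightarrow> bool" where
  "hypergraph V E \<longleftrightarrow> finite V \<and> E \<subseteq> Pow V"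

definition uniform_hypergraph :: "nat \<Rightarrow> 'v set \<Rightarrow> 'v set set \<Rightarrow> bool" where
  "uniform_hypergraph n V E \<longleftrightarrow> hypergraph V E \<and> (\<forall>e\<in>E. card e = n)"

(* A 2-coloring is a map into bool; its values outside V play no role for a
   hypergraph, since every edge is a subset of V. *)
definition property_B :: "nat \<Rightarrow> 'v set \<Rightarrow> 'v set set \<Rightarrow> bool" where
  "property_B k V E \<longleftrightarrow>
     (\<exists>c :: 'v \<Rightarrow> bool. \<forall>e\<in>E. \<forall>b. k \<le> card {v \<in> e. c v = b})"

definition intersecting_edges :: "'v set set \<Rightarrow> 'v set \<Rightarrow> 'v set set" where
  "intersecting_edges E e = {f \<in> E. f \<noteq> e \<and> e \<inter> f \<noteq> {}}"

end

theory Submission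
  imports Defs "HOL-Probability.Probability_Mass_Function" "HOL-Analysis.Harmonic_Numbers"
begin

text \<open>
  Give every vertex an independent uniform weight in \<open>{0..<2 * n}\<close> and colour a vertex red iff it is
  among the top \<open>k\<close> vertices of some edge. Every edge then has \<open>k\<close> red vertices. If an edge \<open>f\<close> has fewer
  than \<open>k\<close> other ones, its lowest red vertex \<open>v\<close> has fewer than \<open>k\<close> vertices of \<open>f\<close> below it and fewer than
  \<open>k\<close> vertices of some edge \<open>e\<close> above it. So either \<open>v\<close> is on one of the \<open>2 * m\<close> middle levels, a conflict of
  the pair \<open>(e, f)\<close>, or an edge lies almost entirely on one side of the middle.

  With \<open>q = (n - 1 choose k - 1) / 2 ^ (n - 1)\<close>, Chernoff bounds give probabilities of order
  \<open>sqrt k * q * exp (- m)\<close> for the second event and \<open>k * q\<^sup>2 * m / n\<close> for the first. Taking \<open>m\<close> about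
  \<open>ln n / 2\<close>, the local lemma tolerates \<open>D\<close> of order \<open>sqrt (n / (k * ln n)) / q\<close>.
\<close>

section \<open>The local lemma for independent weights\<close>

text \<open>Avoiding all events of \<open>J\<close> at most doubles the probability of
  \<open>A i\<close>, by induction on \<open>card J\<close>: the events outside
  \<open>\<Gamma> i\<close> are harmless by independence, and those inside remove at most half of
  what is left, as their total is at most \<open>1 / 4\<close>.\<close>

lemma (in prob_space) lovasz_local:
  assumes "finite I"
    and events: "\<And>i. i \<in> I \<Longrightarrow> A i \<in> events"
    and refl: "\<And>i. i \<in> I \<Longrightarrow> i \<in> \<Gamma> i"
    and indep: "\<And>i J. i \<in> I \<Longrightarrow> J \<subseteq> I - \<Gamma> i \<Longrightarrow>
      prob (A i \<inter> (space M - (\<Union>j\<in>J. A j))) = prob (A i) * prob (space M - (\<Union>j\<in>J. A j))"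
    and sum_le: "\<And>i. i \<in> I \<Longrightarrow> (\<Sum>j\<in>I \<inter> \<Gamma> i. prob (A j)) \<le> 1 / 4"
  shows "prob (space M - (\<Union>i\<in>I. A i)) > 0"
proof -
  define N where "N J = space M - (\<Union>j\<in>J. A j)" for J
  have N_ev: "N J \<in> events" if "J \<subseteq> I" for J
    unfolding N_def using that \<open>finite I\<close> events by (auto intro!: sets.finite_UN intro: finite_subset)
  \<comment> \<open>Multiplying out the conditional probability lets the induction run before
    \<open>prob (N J)\<close> is known to be positive.\<close>
  have cond: "prob (A i \<inter> N J) \<le> 2 * prob (A i) * prob (N J)" if "J \<subseteq> I" "i \<in> I" for i J
    using that
  proof (induction "card J" arbitrary: i J rule: less_induct)
    case less
    define J1 where "J1 = J \<inter> \<Gamma> i"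
    define J2 where "J2 = J - \<Gamma> i"
    have sub: "J1 \<subseteq> I" "J2 \<subseteq> I" and fin: "finite J" "finite J1"
      using less.prems \<open>finite I\<close> by (auto simp: J1_def J2_def intro: finite_subset)
    have "prob (A i \<inter> N J) \<le> prob (A i \<inter> N J2)"
      using events less.prems N_ev sub by (intro finite_measure_mono) (auto simp: N_def J2_def)
    also have "\<dots> = prob (A i) * prob (N J2)"
      unfolding N_def using less.prems by (intro indep) (auto simp: J2_def)
    also have "prob (A i) * prob (N J2) \<le> prob (A i) * (2 * prob (N J))"
    proof (rule mult_left_mono, cases "J1 = {}")
      case True
      then have "J2 = J" by (auto simp: J1_def J2_def)
      then show "prob (N J2) \<le> 2 * prob (N J)" by simp
    next
      case False
      then have "card J2 < card J"
        using fin by (intro psubset_card_mono) (auto simp: J1_def J2_def)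
      then have IH: "prob (A j \<inter> N J2) \<le> 2 * prob (A j) * prob (N J2)" if "j \<in> J1" for j
        using that less.hyps[of J2 j] sub by auto
      \<comment> \<open>\<open>N J2\<close> is covered by \<open>N J\<close> and the events of
        \<open>J1\<close>, which by induction take at most \<open>2 * (1 / 4)\<close> of
        \<open>prob (N J2)\<close>.\<close>
      have "prob (N J2) \<le> prob (N J \<union> (\<Union>j\<in>J1. A j \<inter> N J2))"
        using events less.prems N_ev sub fin
        by (intro finite_measure_mono sets.Un sets.finite_UN) (auto simp: N_def J1_def J2_def)
      also have "\<dots> \<le> prob (N J) + prob (\<Union>j\<in>J1. A j \<inter> N J2)"
        using events less.prems N_ev sub fin
        by (intro measure_Un_le sets.finite_UN) auto
      also have "prob (\<Union>j\<in>J1. A j \<inter> N J2) \<le> (\<Sum>j\<in>J1. prob (A j \<inter> N J2))"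
        using events N_ev sub fin by (intro finite_measure_subadditive_finite) auto
      also have "\<dots> \<le> (\<Sum>j\<in>J1. 2 * prob (A j) * prob (N J2))"
        by (intro sum_mono IH)
      also have "\<dots> = 2 * prob (N J2) * (\<Sum>j\<in>J1. prob (A j))"
        by (simp add: sum_distrib_left mult_ac)
      also have "(\<Sum>j\<in>J1. prob (A j)) \<le> (\<Sum>j\<in>I \<inter> \<Gamma> i. prob (A j))"
        using \<open>finite I\<close> less.prems by (intro sum_mono2) (auto simp: J1_def)
      also have "\<dots> \<le> 1 / 4" using less.prems by (intro sum_le)
      finally show "prob (N J2) \<le> 2 * prob (N J)" by (simp add: mult_left_mono)
    qed simp
    finally show ?case by (simp add: mult_ac)
  qed
  have "prob (N J) > 0" if "J \<subseteq> I" for J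
    using finite_subset[OF that \<open>finite I\<close>] that
  proof (induction J rule: finite_induct)
    case empty
    then show ?case by (simp add: N_def prob_space)
  next
    case (insert i J)
    then have i: "i \<in> I" "J \<subseteq> I" by auto
    \<comment> \<open>Since \<open>i\<close> is its own neighbour, \<open>prob (A i)\<close> is at
      most \<open>1 / 4\<close>, so each new event removes at most half of
      \<open>N J\<close>.\<close>
    have "prob (A i) \<le> (\<Sum>j\<in>I \<inter> \<Gamma> i. prob (A j))"
      using \<open>finite I\<close> i refl by (intro member_le_sum) auto
    then have "prob (A i) \<le> 1 / 4" using sum_le[OF i(1)] by linarith
    then have "2 * prob (A i) * prob (N J) \<le> 2 * (1/4) * prob (N J)"
      by (intro mult_right_mono) auto
    then have "prob (A i \<inter> N J) \<le> prob (N J) / 2"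
      using cond[OF i(2,1)] by linarith
    moreover have "prob (N (insert i J)) = prob (N J) - prob (A i \<inter> N J)"
    proof -
      have "N (insert i J) = N J - (A i \<inter> N J)" by (auto simp: N_def)
      then show ?thesis
        using events i N_ev by (simp add: finite_measure_Diff)
    qed
    ultimately show ?case using insert i by auto
  qed
  then show ?thesis unfolding N_def by blast
qed

section \<open>Independence of events on disjoint sets of vertices\<close>

text \<open>Stated for all functions rather than those in a product space, so that complements can
  be taken in the whole type. One implication suffices, since \<open>f\<close> and \<open>g\<close>
  can be exchanged.\<close>

definition determined_by :: "('v \<Rightarrow> 'a) set \<Rightarrow> 'v set \<Rightarrow> bool" where
  "determined_by A S \<longleftrightarrow> (\<forall>f g. (\<forall>v\<in>S. f v = g v) \<longrightarrow> f \<in> A \<longrightarrow> g \<in> A)"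

text \<open>Exchanging the values of \<open>f\<close> and \<open>g\<close> outside \<open>S\<close>
  is an involution on pairs. It carries the pairs with \<open>f\<close> in \<open>A\<close> and
  \<open>g\<close> in \<open>B\<close> to those whose first component lies in both events; counting
  both sides gives the product formula.\<close>

lemma prob_PiE_indep:
  fixes V :: "'v set" and W :: "'a set"
  defines "P \<equiv> pmf_of_set (PiE V (\<lambda>_. W))"
  assumes "finite V" "finite W" "W \<noteq> {}"
    and A: "determined_by A S" and B: "determined_by B T" and "S \<inter> T = {}"
  shows "measure_pmf.prob P (A \<inter> B) = measure_pmf.prob P A * measure_pmf.prob P B"
proof -
  define \<Omega> where "\<Omega> = PiE V (\<lambda>_. W)"
  have fin: "finite \<Omega>" unfolding \<Omega>_def using assms by (auto intro: finite_PiE)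
  have ne: "\<Omega> \<noteq> {}" unfolding \<Omega>_def using assms by (auto simp: PiE_eq_empty_iff)
  define \<phi> :: "('v \<Rightarrow> 'a) \<times> ('v \<Rightarrow> 'a) \<Rightarrow> ('v \<Rightarrow> 'a) \<times> ('v \<Rightarrow> 'a)" where
    "\<phi> = (\<lambda>(f, g). (\<lambda>v. if v \<in> S then f v else g v, \<lambda>v. if v \<in> S then g v else f v))"
  have inv: "\<phi> (\<phi> p) = p" for p by (cases p) (auto simp: \<phi>_def)
  have \<Omega>: "(\<lambda>v. if v \<in> S then f v else g v) \<in> \<Omega>" if "f \<in> \<Omega>" "g \<in> \<Omega>" for f g
    using that unfolding \<Omega>_def by (auto simp: PiE_iff extensional_def)
  have A_iff: "f \<in> A \<longleftrightarrow> g \<in> A" if "\<And>v. v \<in> S \<Longrightarrow> f v = g v" for f g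
    using A that unfolding determined_by_def by metis
  have B_iff: "f \<in> B \<longleftrightarrow> g \<in> B" if "\<And>v. v \<in> T \<Longrightarrow> f v = g v" for f g
    using B that unfolding determined_by_def by metis
  have ST: "v \<notin> S" if "v \<in> T" for v using that \<open>S \<inter> T = {}\<close> by blast
  have "bij_betw \<phi> ((\<Omega> \<inter> A) \<times> (\<Omega> \<inter> B)) ((\<Omega> \<inter> (A \<inter> B)) \<times> \<Omega>)"
  proof (rule bij_betw_byWitness[where f' = \<phi>])
    have "\<phi> (f, g) \<in> (\<Omega> \<inter> (A \<inter> B)) \<times> \<Omega>" if "f \<in> \<Omega> \<inter> A" "g \<in> \<Omega> \<inter> B" for f g
    proof -
      have "(\<lambda>v. if v \<in> S then f v else g v) \<in> A" using that A_iff[of "\<lambda>v. if v \<in> S then f v else g v" f] by simp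
      moreover have "(\<lambda>v. if v \<in> S then f v else g v) \<in> B"
        using that B_iff[of "\<lambda>v. if v \<in> S then f v else g v" g] ST by simp
      moreover have "(\<lambda>v. if v \<in> S then g v else f v) \<in> \<Omega>" using that \<Omega> by auto
      ultimately show ?thesis using that \<Omega> unfolding \<phi>_def by auto
    qed
    then show "\<phi> ` ((\<Omega> \<inter> A) \<times> (\<Omega> \<inter> B)) \<subseteq> (\<Omega> \<inter> (A \<inter> B)) \<times> \<Omega>" by blast
    have "\<phi> (f, g) \<in> (\<Omega> \<inter> A) \<times> (\<Omega> \<inter> B)" if "f \<in> \<Omega> \<inter> (A \<inter> B)" "g \<in> \<Omega>" for f g
    proof -
      have "(\<lambda>v. if v \<in> S then f v else g v) \<in> A" using that A_iff[of "\<lambda>v. if v \<in> S then f v else g v" f] by simp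
      moreover have "(\<lambda>v. if v \<in> S then g v else f v) \<in> B"
        using that B_iff[of "\<lambda>v. if v \<in> S then g v else f v" f] ST by simp
      moreover have "(\<lambda>v. if v \<in> S then g v else f v) \<in> \<Omega>" using that \<Omega> by auto
      ultimately show ?thesis using that \<Omega> unfolding \<phi>_def by auto
    qed
    then show "\<phi> ` ((\<Omega> \<inter> (A \<inter> B)) \<times> \<Omega>) \<subseteq> (\<Omega> \<inter> A) \<times> (\<Omega> \<inter> B)" by blast
  qed (auto simp: inv)
  then have "card (\<Omega> \<inter> A) * card (\<Omega> \<inter> B) = card (\<Omega> \<inter> (A \<inter> B)) * card \<Omega>"
    by (metis bij_betw_same_card card_cartesian_product)
  then have "real (card (\<Omega> \<inter> A)) * real (card (\<Omega> \<inter> B)) = real (card (\<Omega> \<inter> (A \<inter> B))) * real (card \<Omega>)"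
    by (metis of_nat_mult)
  moreover have "real (card \<Omega>) > 0" using fin ne by (simp add: card_gt_0_iff)
  ultimately show ?thesis
    unfolding P_def \<Omega>_def[symmetric] measure_pmf_of_set[OF ne fin] by (simp add: field_simps)
qed

lemma determined_by_Compl_UN:
  assumes "\<And>j. j \<in> J \<Longrightarrow> determined_by (A j) (S j)"
  shows "determined_by (- (\<Union>j\<in>J. A j)) (\<Union>j\<in>J. S j)"
  unfolding determined_by_def
proof (intro allI impI)
  fix f g assume fg: "\<forall>v\<in>\<Union>j\<in>J. S j. f v = g v" and f: "f \<in> - (\<Union>j\<in>J. A j)"
  have "g \<notin> A j" if "j \<in> J" for j
  proof
    assume "g \<in> A j"
    moreover have "\<forall>v\<in>S j. g v = f v" using fg that by auto
    ultimately have "f \<in> A j" using assms[OF that] unfolding determined_by_def by blast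
    then show False using f that by auto
  qed
  then show "g \<in> - (\<Union>j\<in>J. A j)" by auto
qed

text \<open>The neighbours of \<open>i\<close> are the indices whose support meets
  \<open>S i\<close>; avoiding other events depends on vertices outside \<open>S i\<close>. Nonempty
  supports make every index its own neighbour.\<close>

lemma lovasz_local_PiE:
  fixes V :: "'v set" and W :: "'a set" and A :: "'i \<Rightarrow> ('v \<Rightarrow> 'a) set"
  defines "P \<equiv> pmf_of_set (PiE V (\<lambda>_. W))"
  assumes "finite V" "finite W" "W \<noteq> {}" "finite I"
    and det: "\<And>i. i \<in> I \<Longrightarrow> determined_by (A i) (S i)"
    and ne: "\<And>i. i \<in> I \<Longrightarrow> S i \<noteq> {}"
    and sum_le: "\<And>i. i \<in> I \<Longrightarrow>
      (\<Sum>j\<in>{j \<in> I. S i \<inter> S j \<noteq> {}}. measure_pmf.prob P (A j)) \<le> 1 / 4"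
  shows "\<exists>w \<in> PiE V (\<lambda>_. W). \<forall>i\<in>I. w \<notin> A i"
proof -
  have "measure_pmf.prob P (space (measure_pmf P) - (\<Union>i\<in>I. A i)) > 0"
  proof (rule measure_pmf.lovasz_local[where \<Gamma> = "\<lambda>i. {j. S i \<inter> S j \<noteq> {}}"])
    fix i J assume i: "i \<in> I" and J: "J \<subseteq> I - {j. S i \<inter> S j \<noteq> {}}"
    have "determined_by (- (\<Union>j\<in>J. A j)) (\<Union>j\<in>J. S j)"
      using J det by (intro determined_by_Compl_UN) auto
    then have "measure_pmf.prob P (A i \<inter> - (\<Union>j\<in>J. A j)) =
        measure_pmf.prob P (A i) * measure_pmf.prob P (- (\<Union>j\<in>J. A j))"
      unfolding P_def using J \<open>finite V\<close> \<open>finite W\<close> \<open>W \<noteq> {}\<close>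
      by (intro prob_PiE_indep[OF _ _ _ det[OF i]]) auto
    then show "measure_pmf.prob P (A i \<inter> (space (measure_pmf P) - (\<Union>j\<in>J. A j))) =
        measure_pmf.prob P (A i) * measure_pmf.prob P (space (measure_pmf P) - (\<Union>j\<in>J. A j))"
      by (simp only: space_measure_pmf Compl_eq_Diff_UNIV)
  next
    fix i assume "i \<in> I"
    then show "(\<Sum>j\<in>I \<inter> {j. S i \<inter> S j \<noteq> {}}. measure_pmf.prob P (A j)) \<le> 1 / 4"
      using sum_le[of i] by (simp only: Collect_conj_eq Collect_mem_eq)
  qed (use \<open>finite I\<close> ne in auto)
  moreover have "measure_pmf.prob P X = card (PiE V (\<lambda>_. W) \<inter> X) / card (PiE V (\<lambda>_. W))" for X
    unfolding P_def using assms by (intro measure_pmf_of_set) (auto simp: PiE_eq_empty_iff intro: finite_PiE)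
  ultimately have "0 < real (card (PiE V (\<lambda>_. W) \<inter> (UNIV - (\<Union>i\<in>I. A i)))) / card (PiE V (\<lambda>_. W))"
    by simp
  then have "PiE V (\<lambda>_. W) \<inter> (UNIV - (\<Union>i\<in>I. A i)) \<noteq> {}"
    by (metis card.empty of_nat_0 div_0 less_irrefl)
  then show ?thesis by blast
qed

section \<open>Counting the pairs of edges near a given pair\<close>

text \<open>There are at most \<open>D + 1\<close> choices of \<open>g\<close>; for each, one
  partner is \<open>g\<close> itself, of cost \<open>\<alpha>\<close>, and at most \<open>D\<close>
  are proper neighbours, of cost \<open>\<beta>\<close>.\<close>

lemma sum_intersecting_pairs_le:
  fixes p :: "'v set \<times> 'v set \<Rightarrow> real" and D :: real
  assumes "finite E" and "x \<in> E"
    and D: "\<And>e. e \<in> E \<Longrightarrow> real (card (intersecting_edges E e)) \<le> D"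
    and p: "\<And>e. e \<in> E \<Longrightarrow> p (e, e) \<le> \<alpha>"
      "\<And>e f. \<lbrakk>e \<in> E; f \<in> E; e \<noteq> f; e \<inter> f \<noteq> {}\<rbrakk> \<Longrightarrow> p (e, f) \<le> \<beta>"
    and "0 \<le> \<alpha>" "0 \<le> \<beta>"
  shows "sum p (SIGMA g:insert x (intersecting_edges E x). insert g (intersecting_edges E g))
    \<le> (D + 1) * (\<alpha> + D * \<beta>)"
proof -
  have fin: "finite (intersecting_edges E e)" for e
    using \<open>finite E\<close> by (simp add: intersecting_edges_def)
  have notin: "e \<notin> intersecting_edges E e" for e by (simp add: intersecting_edges_def)
  have "0 \<le> D" using D[OF \<open>x \<in> E\<close>] by linarith
  have inner: "(\<Sum>h\<in>insert g (intersecting_edges E g). p (g, h)) \<le> \<alpha> + D * \<beta>" if "g \<in> E" for g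
  proof -
    have "(\<Sum>h\<in>intersecting_edges E g. p (g, h)) \<le> (\<Sum>h\<in>intersecting_edges E g. \<beta>)"
      using that by (intro sum_mono p) (auto simp: intersecting_edges_def)
    also have "\<dots> = real (card (intersecting_edges E g)) * \<beta>" by simp
    also have "\<dots> \<le> D * \<beta>" using D[OF that] \<open>0 \<le> \<beta>\<close> by (intro mult_right_mono)
    finally show ?thesis using p(1)[OF that] fin notin by simp
  qed
  have "sum p (SIGMA g:insert x (intersecting_edges E x). insert g (intersecting_edges E g))
      = (\<Sum>g\<in>insert x (intersecting_edges E x). \<Sum>h\<in>insert g (intersecting_edges E g). p (g, h))"
    using fin by (subst sum.Sigma) auto
  also have "\<dots> \<le> (\<Sum>g\<in>insert x (intersecting_edges E x). \<alpha> + D * \<beta>)"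
    using \<open>x \<in> E\<close> by (intro sum_mono inner) (auto simp: intersecting_edges_def)
  also have "\<dots> = (real (card (intersecting_edges E x)) + 1) * (\<alpha> + D * \<beta>)"
    using fin notin by (simp add: algebra_simps)
  also have "\<dots> \<le> (D + 1) * (\<alpha> + D * \<beta>)"
    using D[OF \<open>x \<in> E\<close>] \<open>0 \<le> \<alpha>\<close> \<open>0 \<le> \<beta>\<close> \<open>0 \<le> D\<close> by (intro mult_right_mono) auto
  finally show ?thesis .
qed

text \<open>If the unions meet, one of \<open>g\<close>, \<open>h\<close> meets one of
  \<open>x\<close>, \<open>y\<close>. These four cases are covered by \<open>T x\<close>,
  \<open>T y\<close> and their mirror images; counting a pair repeatedly is harmless as
  \<open>p\<close> is nonnegative.\<close>

lemma sum_neighbouring_pairs_le: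
  fixes p :: "'v set \<times> 'v set \<Rightarrow> real" and D :: real and E :: "'v set set"
  defines "I \<equiv> {(e, f). e \<in> E \<and> f \<in> E \<and> e \<inter> f \<noteq> {}}"
  assumes "finite E" and x: "x \<in> E" and y: "y \<in> E"
    and D: "\<And>e. e \<in> E \<Longrightarrow> real (card (intersecting_edges E e)) \<le> D"
    and p: "\<And>e. e \<in> E \<Longrightarrow> p (e, e) \<le> \<alpha>"
      "\<And>e f. \<lbrakk>e \<in> E; f \<in> E; e \<noteq> f; e \<inter> f \<noteq> {}\<rbrakk> \<Longrightarrow> p (e, f) \<le> \<beta>"
    and nonneg: "\<And>i. 0 \<le> p i" "0 \<le> \<alpha>" "0 \<le> \<beta>"
  shows "sum p {(g, h) \<in> I. (x \<union> y) \<inter> (g \<union> h) \<noteq> {}} \<le> 4 * ((D + 1) * (\<alpha> + D * \<beta>))"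
proof -
  define T where "T x = (SIGMA g:insert x (intersecting_edges E x). insert g (intersecting_edges E g))" for x
  have fin: "finite (T x)" for x
    using \<open>finite E\<close> by (auto simp: T_def intersecting_edges_def)
  have un: "sum p (A \<union> B) \<le> sum p A + sum p B" if "finite A" "finite B" for A B
  proof -
    have "0 \<le> sum p (A \<inter> B)" using nonneg by (simp add: sum_nonneg)
    then show ?thesis using sum.union_inter[OF that, of p] by linarith
  qed
  have T: "sum p (T x) \<le> (D + 1) * (\<alpha> + D * \<beta>)" if "x \<in> E" for x
    unfolding T_def using assms that by (intro sum_intersecting_pairs_le) auto
  have swap: "sum p (prod.swap ` T x) \<le> (D + 1) * (\<alpha> + D * \<beta>)" if "x \<in> E" for x
  proof -
    have "sum p (prod.swap ` T x) = sum (p \<circ> prod.swap) (T x)"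
      by (intro sum.reindex) simp
    also have "\<dots> \<le> (D + 1) * (\<alpha> + D * \<beta>)"
      unfolding T_def using assms that by (intro sum_intersecting_pairs_le) (auto simp: Int_commute)
    finally show ?thesis .
  qed
  have "{(g, h) \<in> I. (x \<union> y) \<inter> (g \<union> h) \<noteq> {}} \<subseteq> (T x \<union> prod.swap ` T x) \<union> (T y \<union> prod.swap ` T y)"
    (is "?L \<subseteq> _")
  proof
    fix i assume "i \<in> ?L"
    then obtain g h where i: "i = (g, h)" "g \<in> E" "h \<in> E" "g \<inter> h \<noteq> {}" "(x \<union> y) \<inter> (g \<union> h) \<noteq> {}"
      by (auto simp: I_def)
    have mem: "(a, b) \<in> T c" if "a \<in> E" "b \<in> E" "a \<inter> b \<noteq> {}" "c \<inter> a \<noteq> {}" for a b c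
      using that by (auto simp: T_def intersecting_edges_def)
    have swap_mem: "(g, h) \<in> prod.swap ` T c" if "(h, g) \<in> T c" for c
      using that by (metis pair_in_swap_image)
    consider "x \<inter> g \<noteq> {}" | "x \<inter> h \<noteq> {}" | "y \<inter> g \<noteq> {}" | "y \<inter> h \<noteq> {}" using i(5) by blast
    then show "i \<in> (T x \<union> prod.swap ` T x) \<union> (T y \<union> prod.swap ` T y)"
      using mem[of g h] mem[of h g] swap_mem i by cases (auto simp: Int_commute)
  qed
  then have "sum p ?L \<le> sum p ((T x \<union> prod.swap ` T x) \<union> (T y \<union> prod.swap ` T y))"
    using fin nonneg by (intro sum_mono2) auto
  also have "\<dots> \<le> sum p (T x \<union> prod.swap ` T x) + sum p (T y \<union> prod.swap ` T y)"
    using fin nonneg by (intro un) auto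
  also have "\<dots> \<le> (sum p (T x) + sum p (prod.swap ` T x)) + (sum p (T y) + sum p (prod.swap ` T y))"
    using fin nonneg by (intro add_mono un) auto
  also have "\<dots> \<le> 4 * ((D + 1) * (\<alpha> + D * \<beta>))"
    using T[OF x] T[OF y] swap[OF x] swap[OF y] by linarith
  finally show ?thesis .
qed

section \<open>Chernoff bounds\<close>

text \<open>Markov's inequality for a product weight: \<open>K * (\<Prod>v\<in>U. h v (w v))\<close>
  dominates the indicator of \<open>A\<close>, and its expectation factors over the independent
  coordinates.\<close>

lemma prob_PiE_le_prod:
  fixes h :: "'v \<Rightarrow> 'a \<Rightarrow> real"
  assumes "finite V" "finite W" "W \<noteq> {}" "U \<subseteq> V"
    and h: "\<And>v x. h v x \<ge> 0" and "K \<ge> 0"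
    and le: "\<And>w. w \<in> A \<Longrightarrow> 1 \<le> K * (\<Prod>v\<in>U. h v (w v))"
  shows "measure_pmf.prob (pmf_of_set (PiE V (\<lambda>_. W))) A \<le> K * (\<Prod>v\<in>U. (\<Sum>x\<in>W. h v x) / card W)"
proof -
  define \<Omega> where "\<Omega> = PiE V (\<lambda>_. W)"
  have fin: "finite \<Omega>" unfolding \<Omega>_def using assms by (auto intro: finite_PiE)
  have ne: "\<Omega> \<noteq> {}" unfolding \<Omega>_def using assms by (auto simp: PiE_eq_empty_iff)
  have U: "V \<inter> U = U" using assms by auto
  \<comment> \<open>Padding with \<open>1\<close> outside \<open>U\<close> lets the sum over the
    full product space factor; padded coordinates average to \<open>1\<close>.\<close>
  define h' where "h' v x = (if v \<in> U then h v x else 1)" for v x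
  have "real (card (\<Omega> \<inter> A)) = (\<Sum>w\<in>\<Omega> \<inter> A. 1)" by simp
  also have "\<dots> \<le> (\<Sum>w\<in>\<Omega> \<inter> A. K * (\<Prod>v\<in>U. h v (w v)))"
    using le by (intro sum_mono) auto
  also have "\<dots> \<le> (\<Sum>w\<in>\<Omega>. K * (\<Prod>v\<in>U. h v (w v)))"
    using fin h \<open>K \<ge> 0\<close> by (intro sum_mono2) (auto intro!: mult_nonneg_nonneg prod_nonneg)
  also have "\<dots> = K * (\<Sum>w\<in>\<Omega>. \<Prod>v\<in>V. h' v (w v))"
    using \<open>finite V\<close> U by (simp add: sum_distrib_left h'_def prod.If_cases)
  also have "(\<Sum>w\<in>\<Omega>. \<Prod>v\<in>V. h' v (w v)) = (\<Prod>v\<in>V. \<Sum>x\<in>W. h' v x)"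
    unfolding \<Omega>_def using assms by (subst prod_sum_PiE) auto
  finally have "real (card (\<Omega> \<inter> A)) / real (card \<Omega>) \<le> K * (\<Prod>v\<in>V. \<Sum>x\<in>W. h' v x) / real (card \<Omega>)"
    by (intro divide_right_mono) auto
  also have card: "real (card \<Omega>) = (\<Prod>v\<in>V. real (card W))"
    unfolding \<Omega>_def using assms by (simp add: card_PiE)
  also have "K * (\<Prod>v\<in>V. \<Sum>x\<in>W. h' v x) / (\<Prod>v\<in>V. real (card W)) =
      K * (\<Prod>v\<in>V. (\<Sum>x\<in>W. h' v x) / real (card W))"
    by (simp only: prod_dividef times_divide_eq_right)
  also have "(\<Prod>v\<in>V. (\<Sum>x\<in>W. h' v x) / real (card W)) =
      (\<Prod>v\<in>V. if v \<in> U then (\<Sum>x\<in>W. h v x) / real (card W) else 1)"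
    using assms by (intro prod.cong) (auto simp: h'_def)
  also have "\<dots> = (\<Prod>v\<in>U. (\<Sum>x\<in>W. h v x) / card W)"
    using \<open>finite V\<close> U by (simp add: prod.If_cases)
  finally show ?thesis unfolding \<Omega>_def[symmetric] measure_pmf_of_set[OF ne fin] card .
qed

section \<open>Stirling's bound and binomial coefficients\<close>

text \<open>The constant \<open>exp 1\<close> makes \<open>j = 1\<close> an equality; the induction
  step amounts to \<open>exp 1 \<le> (1 + 1 / x) powr (x + 1 / 2)\<close>.\<close>

lemma fact_le_Stirling:
  assumes "j \<ge> 1"
  shows "fact j \<le> exp 1 * sqrt (real j) * (real j / exp 1) ^ j"
  using assms
proof (induction j rule: nat_induct_at_least)
  case base
  then show ?case by simp
next
  case (Suc j)
  define x where "x = real j"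
  have x: "x > 0" using Suc by (simp add: x_def)
  \<comment> \<open>The midpoint rule underestimates the integral of the convex function
    \<open>1 / t\<close> from \<open>x\<close> to \<open>x + 1\<close>.\<close>
  have "ln (x + 1) - ln x \<ge> 2 / (2 * x + 1)"
    using ln_inverse_approx_ge[of x "x + 1"] x by (simp add: add_ac)
  then have "1 \<le> (x + 1/2) * (ln (x + 1) - ln x)"
    using x by (simp add: field_simps)
  then have "exp 1 \<le> exp ((x + 1/2) * ln ((x + 1) / x))"
    using x by (simp add: ln_div)
  also have "\<dots> = ((x + 1) / x) powr (x + 1/2)"
    using x by (simp add: powr_def)
  also have "\<dots> = ((x + 1) / x) ^ j * sqrt ((x + 1) / x)"
    using x by (simp add: powr_add powr_half_sqrt x_def powr_realpow)
  also have "\<dots> = (x + 1) ^ j / x ^ j * (sqrt (x + 1) / sqrt x)"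
    by (simp add: power_divide real_sqrt_divide)
  finally have key: "exp 1 * (x ^ j * sqrt x) \<le> (x + 1) ^ j * sqrt (x + 1)"
    using x by (simp add: field_simps)
  have "fact (Suc j) = (x + 1) * fact j" by (simp add: x_def)
  also have "\<dots> \<le> (x + 1) * (exp 1 * sqrt x * (x / exp 1) ^ j)"
    using Suc x unfolding x_def by (intro mult_left_mono) auto
  also have "\<dots> = (x + 1) / exp 1 ^ j * (exp 1 * (x ^ j * sqrt x))"
    by (simp add: power_divide)
  also have "\<dots> \<le> (x + 1) / exp 1 ^ j * ((x + 1) ^ j * sqrt (x + 1))"
    using x by (intro mult_left_mono key) auto
  also have "\<dots> = exp 1 * sqrt (real (Suc j)) * (real (Suc j) / exp 1) ^ Suc j"
    by (simp add: x_def power_divide add_ac)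
  finally show ?case .
qed

text \<open>The right side is the falling factorial of \<open>N\<close>, and a product of factors
  \<open>1 - s / N\<close> with \<open>s < i\<close> is at least one minus the sum of the
  \<open>s / N\<close>.\<close>

lemma fact_times_binomial_ge:
  assumes "i \<le> N"
  shows "real N ^ i * (1 - real i * (real i - 1) / (2 * real N)) \<le> fact i * real (N choose i)"
  using assms
proof (induction i)
  case 0
  then show ?case by simp
next
  case (Suc i)
  define x y where "x = real i" and "y = real N"
  have xy: "0 \<le> x" "x < y" using Suc by (auto simp: x_def y_def)
  have "(Suc i) * (N choose Suc i) = (N - i) * (N choose i)"
    by (metis binomial_absorption binomial_absorb_comp)
  then have "real ((Suc i) * (N choose Suc i)) = real ((N - i) * (N choose i))" by simp
  then have step: "(x + 1) * real (N choose Suc i) = (y - x) * real (N choose i)"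
    using Suc unfolding x_def y_def of_nat_mult by (simp add: of_nat_diff add_ac)
  \<comment> \<open>The two sides differ exactly by
    \<open>x * (x * (x - 1) / (2 * y))\<close>.\<close>
  have "y * (1 - (x + 1) * x / (2 * y)) \<le> (y - x) * (1 - x * (x - 1) / (2 * y))"
  proof (cases "i = 0")
    case False
    then have "1 \<le> x" by (simp add: x_def)
    then have "0 \<le> x * (x * (x - 1) / (2 * y))" using xy by simp
    then show ?thesis using xy by (simp add: field_simps)
  qed (simp add: x_def)
  then have "y ^ i * (y * (1 - (x + 1) * x / (2 * y))) \<le> y ^ i * ((y - x) * (1 - x * (x - 1) / (2 * y)))"
    using xy by (intro mult_left_mono) auto
  also have "\<dots> = (y - x) * (y ^ i * (1 - x * (x - 1) / (2 * y)))" by simp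
  also have "\<dots> \<le> (y - x) * (fact i * real (N choose i))"
    using Suc xy unfolding x_def y_def by (intro mult_left_mono) auto
  also have "\<dots> = fact i * ((x + 1) * real (N choose Suc i))" using step by simp
  also have "\<dots> = fact (Suc i) * real (N choose Suc i)" by (simp add: x_def)
  finally show ?case by (simp add: x_def y_def mult_ac add_ac)
qed

text \<open>The left side is \<open>(1 / z) ^ j * (1 + z) ^ N\<close> at \<open>z = j / N\<close>.
  The bound \<open>exp j\<close> for \<open>(1 + z) ^ N\<close> cancels against Stirling's, and
  \<open>j * (j - 1) \<le> N\<close> keeps the falling factorial above \<open>N ^ j / 2\<close>;
  only \<open>sqrt j\<close> and constants are lost.\<close>

lemma binomial_ge_Chernoff:
  assumes "1 \<le> j" "j \<le> N" "j * (j - 1) \<le> N"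
  shows "(real N / real j) ^ j * (1 + real j / real N) ^ N \<le> 2 * exp 1 * sqrt (real j) * real (N choose j)"
proof -
  have pos: "real j > 0" "real N > 0" using assms by auto
  have "(1 + real j / real N) ^ N \<le> exp (real j / real N) ^ N"
    using pos by (intro power_mono) auto
  also have "\<dots> = exp (real j)" using pos by (simp flip: exp_of_nat_mult)
  finally have 1: "(1 + real j / real N) ^ N \<le> exp 1 ^ j" by (simp flip: exp_of_nat_mult)
  have "real (j * (j - 1)) \<le> real N" using assms by (intro of_nat_mono)
  then have "real j * (real j - 1) / (2 * real N) \<le> 1 / 2"
    using assms pos by (simp add: of_nat_diff field_simps)
  then have "real N ^ j * (1 / 2) \<le> real N ^ j * (1 - real j * (real j - 1) / (2 * real N))"
    using pos by (intro mult_left_mono) auto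
  also have "\<dots> \<le> fact j * real (N choose j)" by (rule fact_times_binomial_ge) fact
  also have "\<dots> \<le> exp 1 * sqrt (real j) * (real j / exp 1) ^ j * real (N choose j)"
    using fact_le_Stirling[OF assms(1)] by (intro mult_right_mono) auto
  finally have "real N ^ j * (1 / 2) \<le> exp 1 * sqrt (real j) * (real j / exp 1) ^ j * real (N choose j)" .
  then have 2: "(real N / real j) ^ j * exp 1 ^ j \<le> 2 * exp 1 * sqrt (real j) * real (N choose j)"
    using pos by (simp add: field_simps)
  have "(real N / real j) ^ j * (1 + real j / real N) ^ N \<le> (real N / real j) ^ j * exp 1 ^ j"
    using 1 by (intro mult_left_mono) auto
  then show ?thesis using 2 by linarith
qed

section \<open>Exponential moments of weight counts\<close>

lemma prod_if_eq_power:
  fixes z :: real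
  assumes "finite e"
  shows "(\<Prod>u\<in>e. if Q u then z else 1) = z ^ card {u \<in> e. Q u}"
  using assms by (simp add: prod.If_cases Int_def)

lemma sum_if_mem:
  fixes p q :: real
  assumes "finite W"
  shows "(\<Sum>x\<in>W. if x \<in> B then p else q) = real (card (W \<inter> B)) * p + real (card (W - B)) * q"
  using assms by (simp add: sum.If_cases Diff_eq)

text \<open>The indicator of \<open>c \<le> j\<close> is dominated by \<open>z ^ c / z ^ j\<close>;
  with \<open>c\<close> a count of vertices this is a product over them, as Markov's inequality
  needs.\<close>

lemma one_le_Chernoff_factor:
  fixes z :: real
  assumes "0 < z" "z \<le> 1" "c \<le> j"
  shows "1 \<le> (1 / z) ^ j * z ^ c"
proof -
  have "z ^ j \<le> z ^ c" using assms by (intro power_decreasing) auto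
  then show ?thesis using assms by (simp add: field_simps)
qed

text \<open>A lower tail by the moment of \<open>z ^ c\<close>, where \<open>c\<close> counts the
  vertices with weight in \<open>B\<close>: a vertex contributes \<open>z\<close> inside
  \<open>B\<close> and \<open>1\<close> outside.\<close>

lemma prob_few_le:
  fixes V :: "'v set" and W :: "'a set" and z :: real
  assumes "finite V" "finite W" "W \<noteq> {}" "e \<subseteq> V" and z: "0 < z" "z \<le> 1"
  shows "measure_pmf.prob (pmf_of_set (PiE V (\<lambda>_. W))) {w. card {u \<in> e. w u \<in> B} \<le> j}
    \<le> (1 / z) ^ j * ((real (card (W - B)) + real (card (W \<inter> B)) * z) / real (card W)) ^ card e"
proof -
  have fin: "finite e" using assms by (auto intro: finite_subset)
  have "measure_pmf.prob (pmf_of_set (PiE V (\<lambda>_. W))) {w. card {u \<in> e. w u \<in> B} \<le> j}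
    \<le> (1 / z) ^ j * (\<Prod>u\<in>e. (\<Sum>x\<in>W. if x \<in> B then z else 1) / real (card W))"
    using assms fin one_le_Chernoff_factor[OF z]
    by (intro prob_PiE_le_prod) (auto simp: prod_if_eq_power)
  also have "(\<Sum>x\<in>W. if x \<in> B then z else 1) = real (card (W - B)) + real (card (W \<inter> B)) * z"
    using assms by (simp add: sum_if_mem)
  finally show ?thesis by simp
qed

text \<open>The levels at most \<open>i\<close> and the levels at least \<open>i\<close> overlap in one level, which accounts for the
  factor \<open>1 + 1 / M\<close>. The two edges together are worst when \<open>i\<close> lies in the middle, by AM-GM.\<close>

lemma prob_conflict_at_le:
  fixes V :: "'v set" and z :: real
  defines "P M \<equiv> pmf_of_set (PiE V (\<lambda>_. {..<M}))"
  assumes "finite V" "e \<subseteq> V" "f \<subseteq> V" "v \<in> e \<inter> f" "i < M" and z: "0 < z" "z \<le> 1"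
    and card: "card e = n" "card f = n"
  shows "measure_pmf.prob (P M)
      {w. w v = i \<and> card {u \<in> e. i < w u} \<le> j \<and> card {u \<in> f. w u < i} \<le> j}
    \<le> (1 / z) ^ (2 * j) * (1 / real M) * (z + 1 / real M) ^ (card (e \<inter> f) - 1)
      * ((1 + 1 / real M) * ((1 + z) / 2)) ^ (2 * (n - card (e \<inter> f)))"
proof -
  have fin: "finite e" "finite f" using assms by (auto intro: finite_subset)
  have M: "real M > 0" using assms by auto
  define x y where "x = (real i + 1) / real M" and "y = (real M - real i) / real M"
  have xy: "0 \<le> x" "0 \<le> y" "x + y = 1 + 1 / real M"
    using \<open>i < M\<close> M by (auto simp: x_def y_def field_simps)
  \<comment> \<open>\<open>g\<close> charges \<open>z\<close> for a vertex of \<open>e\<close> above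
    level \<open>i\<close> and for a vertex of \<open>f\<close> below it; \<open>h\<close> also
    vanishes unless \<open>v\<close> sits on level \<open>i\<close>, and \<open>s\<close> averages
    \<open>h\<close> over the levels.\<close>
  define g where "g u c = (if u \<in> e \<and> i < c then z else 1) * (if u \<in> f \<and> c < i then z else 1)" for u c
  define h where "h u c = (if u = v \<and> c \<noteq> i then 0 else 1) * g u c" for u c
  define s where "s u = (\<Sum>c<M. h u c) / real M" for u
  have "measure_pmf.prob (P M)
      {w. w v = i \<and> card {u \<in> e. i < w u} \<le> j \<and> card {u \<in> f. w u < i} \<le> j}
    \<le> (1 / z) ^ (2 * j) * (\<Prod>u\<in>e \<union> f. (\<Sum>c\<in>{..<M}. h u c) / real (card {..<M}))"
    unfolding P_def
  proof (rule prob_PiE_le_prod)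
    fix w assume "w \<in> {w. w v = i \<and> card {u \<in> e. i < w u} \<le> j \<and> card {u \<in> f. w u < i} \<le> j}"
    then have w: "w v = i" "card {u \<in> e. i < w u} \<le> j" "card {u \<in> f. w u < i} \<le> j" by auto
    have "(\<Prod>u\<in>e \<union> f. h u (w u)) = (\<Prod>u\<in>e \<union> f. g u (w u))"
      using w by (intro prod.cong) (auto simp: h_def)
    also have "\<dots> = z ^ card {u \<in> e \<union> f. u \<in> e \<and> i < w u} * z ^ card {u \<in> e \<union> f. u \<in> f \<and> w u < i}"
      using fin unfolding g_def by (simp add: prod.distrib prod_if_eq_power)
    also have "{u \<in> e \<union> f. u \<in> e \<and> i < w u} = {u \<in> e. i < w u}" by auto
    also have "{u \<in> e \<union> f. u \<in> f \<and> w u < i} = {u \<in> f. w u < i}" by auto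
    finally have eq: "(1 / z) ^ (2 * j) * (\<Prod>u\<in>e \<union> f. h u (w u)) =
        ((1 / z) ^ j * z ^ card {u \<in> e. i < w u}) * ((1 / z) ^ j * z ^ card {u \<in> f. w u < i})"
      by (simp add: mult_2 power_add)
    have "1 * 1 \<le> ((1 / z) ^ j * z ^ card {u \<in> e. i < w u}) * ((1 / z) ^ j * z ^ card {u \<in> f. w u < i})"
      using w z by (intro mult_mono one_le_Chernoff_factor) auto
    then show "1 \<le> (1 / z) ^ (2 * j) * (\<Prod>u\<in>e \<union> f. h u (w u))" by (simp only: eq mult_1)
  qed (use assms in \<open>auto simp: h_def g_def lessThan_empty_iff\<close>)
  also have "(\<Prod>u\<in>e \<union> f. (\<Sum>c\<in>{..<M}. h u c) / real (card {..<M})) = (\<Prod>u\<in>e \<union> f. s u)"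
    by (simp add: s_def)
  also have "e \<union> f = insert v (e \<inter> f - {v}) \<union> ((e - f) \<union> (f - e))"
    using assms by auto
  also have "(\<Prod>u\<in>\<dots>. s u) = s v * (\<Prod>u\<in>e \<inter> f - {v}. s u) * ((\<Prod>u\<in>e - f. s u) * (\<Prod>u\<in>f - e. s u))"
  proof -
    have "prod s (insert v (e \<inter> f - {v}) \<union> ((e - f) \<union> (f - e))) =
        prod s (insert v (e \<inter> f - {v})) * prod s ((e - f) \<union> (f - e))"
      using fin \<open>v \<in> e \<inter> f\<close> by (intro prod.union_disjoint) auto
    also have "prod s (insert v (e \<inter> f - {v})) = s v * prod s (e \<inter> f - {v})"
      using fin by (intro prod.insert) auto
    also have "prod s ((e - f) \<union> (f - e)) = prod s (e - f) * prod s (f - e)"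
      using fin by (intro prod.union_disjoint) auto
    finally show ?thesis .
  qed
  also have "s v = 1 / real M"
  proof -
    have "(\<Sum>c<M. h v c) = (\<Sum>c<M. if c = i then 1 else 0)"
      by (intro sum.cong) (auto simp: h_def g_def)
    also have "\<dots> = 1" using \<open>i < M\<close> by simp
    finally show ?thesis by (simp add: s_def)
  qed
  also have "1 / real M * (\<Prod>u\<in>e \<inter> f - {v}. s u) * ((\<Prod>u\<in>e - f. s u) * (\<Prod>u\<in>f - e. s u))
    \<le> 1 / real M * (\<Prod>u\<in>e \<inter> f - {v}. z + 1 / real M) * ((\<Prod>u\<in>e - f. x + y * z) * (\<Prod>u\<in>f - e. y + x * z))"
  proof -
    have s_nonneg: "0 \<le> s u" for u
      unfolding s_def h_def g_def using z by (auto intro!: sum_nonneg divide_nonneg_nonneg)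
    \<comment> \<open>A common vertex escapes the factor \<open>z\<close> only on level
      \<open>i\<close> itself.\<close>
    have s_both: "s u \<le> z + 1 / real M" if "u \<in> e \<inter> f - {v}" for u
    proof -
      have "(\<Sum>c<M. h u c) \<le> (\<Sum>c<M. z + (if c = i then 1 else 0))"
        using that z by (intro sum_mono) (auto simp: h_def g_def)
      also have "\<dots> = real M * z + 1" using \<open>i < M\<close> by (simp add: sum.distrib)
      finally show ?thesis using M by (simp add: s_def field_simps)
    qed
    have s_e: "s u \<le> x + y * z" if "u \<in> e - f" for u
    proof -
      have "(\<Sum>c<M. h u c) = (\<Sum>c<M. if c \<in> {..i} then 1 else z)"
        using that assms by (intro sum.cong) (auto simp: h_def g_def)
      also have "\<dots> = real (card ({..<M} \<inter> {..i})) + real (card ({..<M} - {..i})) * z"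
        by (subst sum_if_mem) simp_all
      also have "{..<M} \<inter> {..i} = {..<Suc i}" using \<open>i < M\<close> by auto
      also have "{..<M} - {..i} = {Suc i..<M}" by auto
      \<comment> \<open>Only \<open>M - i - 1\<close> levels lie above \<open>i\<close>; rounding up
        to \<open>M - i\<close>, and likewise \<open>i\<close> to \<open>i + 1\<close> for
        \<open>f\<close>, lets both edges share \<open>x\<close> and \<open>y\<close>.\<close>
      also have "real (card {..<Suc i}) + real (card {Suc i..<M}) * z \<le> (real i + 1) + (real M - real i) * z"
        using z \<open>i < M\<close> by (simp add: of_nat_diff mult_right_mono)
      finally have "(\<Sum>c<M. h u c) / real M \<le> ((real i + 1) + (real M - real i) * z) / real M"
        using M by (intro divide_right_mono) auto
      then show ?thesis using M by (simp add: s_def x_def y_def add_divide_distrib)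
    qed
    have s_f: "s u \<le> y + x * z" if "u \<in> f - e" for u
    proof -
      have "(\<Sum>c<M. h u c) = (\<Sum>c<M. if c \<in> {..<i} then z else 1)"
        using that assms by (intro sum.cong) (auto simp: h_def g_def)
      also have "\<dots> = real (card ({..<M} \<inter> {..<i})) * z + real (card ({..<M} - {..<i}))"
        by (subst sum_if_mem) simp_all
      also have "{..<M} \<inter> {..<i} = {..<i}" using \<open>i < M\<close> by auto
      also have "{..<M} - {..<i} = {i..<M}" by auto
      also have "real (card {..<i}) * z + real (card {i..<M}) \<le> (real M - real i) + (real i + 1) * z"
        using z \<open>i < M\<close> by (simp add: of_nat_diff mult_right_mono)
      finally have "(\<Sum>c<M. h u c) / real M \<le> ((real M - real i) + (real i + 1) * z) / real M"
        using M by (intro divide_right_mono) auto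
      then show ?thesis
        unfolding s_def x_def y_def
        by (simp only: add_divide_distrib[of "real M - real i"] times_divide_eq_left)
    qed
    have ge0: "0 \<le> z + 1 / real M" "0 \<le> x + y * z" "0 \<le> y + x * z"
      using z xy M by (auto intro!: add_nonneg_nonneg mult_nonneg_nonneg)
    show ?thesis
      using s_nonneg s_both s_e s_f ge0 M
      by (intro mult_mono prod_mono mult_nonneg_nonneg prod_nonneg conjI) auto
  qed
  also have "\<dots> = 1 / real M * (z + 1 / real M) ^ (card (e \<inter> f) - 1) * ((x + y * z) * (y + x * z)) ^ (n - card (e \<inter> f))"
  proof -
    have "card (e \<inter> f - {v}) = card (e \<inter> f) - 1" using fin assms by simp
    moreover have "card (e - f) = n - card (e \<inter> f)" "card (f - e) = n - card (e \<inter> f)"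
      using card_Diff_subset_Int[of e f] card_Diff_subset_Int[of f e] fin card by (auto simp: Int_commute)
    ultimately show ?thesis by (simp add: power_mult_distrib)
  qed
  also have "\<dots> \<le> 1 / real M * (z + 1 / real M) ^ (card (e \<inter> f) - 1) *
      (((1 + 1 / real M) * ((1 + z) / 2))\<^sup>2) ^ (n - card (e \<inter> f))"
  proof -
    have "(x + y * z) * (y + x * z) \<le> ((x + y) * ((1 + z) / 2))\<^sup>2"
    proof -
      have "((x + y) * ((1 + z) / 2))\<^sup>2 - (x + y * z) * (y + x * z) = ((x - y) * (1 - z) / 2)\<^sup>2"
        by (simp add: power2_eq_square field_simps)
      then show ?thesis by (smt (verit) zero_le_power2)
    qed
    then show ?thesis
      using xy z M by (intro mult_left_mono power_mono) (auto intro!: mult_nonneg_nonneg add_nonneg_nonneg)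
  qed
  finally show ?thesis using z by (simp add: mult_left_mono mult.assoc flip: power_mult)
qed

text \<open>A union bound over the \<open>t\<close> common vertices and the levels in
  \<open>{a..<b}\<close>. Each further common vertex trades \<open>((1 + z) / 2)\<^sup>2\<close> for
  \<open>z + 1 / (2 * n) \<le> 1 / 8\<close>, which pays for the factor \<open>t\<close>.\<close>

lemma prob_conflict_le:
  fixes V :: "'v set" and z :: real
  defines "P M \<equiv> pmf_of_set (PiE V (\<lambda>_. {..<M}))"
  assumes "finite V" "e \<subseteq> V" "f \<subseteq> V" "e \<inter> f \<noteq> {}" "b \<le> 2 * n" "a \<le> b" "n > 0"
    and z: "0 < z" "z + 1 / real (2 * n) \<le> 1 / 8"
    and card: "card e = n" "card f = n"
  shows "measure_pmf.prob (P (2 * n))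
      {w. \<exists>v\<in>e \<inter> f. a \<le> w v \<and> w v < b \<and> card {u \<in> e. w v < w u} \<le> j \<and> card {u \<in> f. w u < w v} \<le> j}
    \<le> exp 1 * (real (b - a) / real (2 * n)) * ((1 / z) ^ j * ((1 + z) / 2) ^ (n - 1))\<^sup>2"
proof -
  define \<delta> where "\<delta> = 1 / real (2 * n)"
  have \<delta>: "\<delta> > 0" using \<open>n > 0\<close> by (simp add: \<delta>_def)
  have fin: "finite e" "finite f" using assms by (auto intro: finite_subset)
  define t where "t = card (e \<inter> f)"
  have t: "1 \<le> t" "t \<le> n"
    using assms fin card_mono[of e "e \<inter> f"] by (auto simp: t_def Suc_le_eq card_gt_0_iff)
  have z1: "z \<le> 1" using z(2) \<delta> unfolding \<delta>_def by linarith
  define X where "X v i = {w. w v = i \<and> card {u \<in> e. i < w u} \<le> j \<and> card {u \<in> f. w u < i} \<le> j}"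
    for v and i :: nat
  define B where "B = (1 / z) ^ (2 * j) * \<delta> * (z + \<delta>) ^ (t - 1) * ((1 + \<delta>) * ((1 + z) / 2)) ^ (2 * (n - t))"
  have X: "measure_pmf.prob (P (2 * n)) (X v i) \<le> B" if "v \<in> e \<inter> f" "i < 2 * n" for v i
    unfolding B_def \<delta>_def t_def X_def P_def using that assms z1 by (intro prob_conflict_at_le) auto
  have "measure_pmf.prob (P (2 * n))
      {w. \<exists>v\<in>e \<inter> f. a \<le> w v \<and> w v < b \<and> card {u \<in> e. w v < w u} \<le> j \<and> card {u \<in> f. w u < w v} \<le> j}
    \<le> measure_pmf.prob (P (2 * n)) (\<Union>(v, i)\<in>(e \<inter> f) \<times> {a..<b}. X v i)"
    by (intro measure_pmf.finite_measure_mono) (auto simp: X_def)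
  also have "\<dots> \<le> (\<Sum>(v, i)\<in>(e \<inter> f) \<times> {a..<b}. measure_pmf.prob (P (2 * n)) (X v i))"
    using fin measure_pmf.finite_measure_subadditive_finite[of "(e \<inter> f) \<times> {a..<b}" "\<lambda>(v, i). X v i" "P (2 * n)"]
    by (simp add: case_prod_unfold)
  also have "\<dots> \<le> (\<Sum>(v, i)\<in>(e \<inter> f) \<times> {a..<b}. B)"
    using X \<open>b \<le> 2 * n\<close> by (intro sum_mono) auto
  also have "\<dots> = real t * real (b - a) * B" by (simp add: t_def card_cartesian_product)
  also have "\<dots> = real (b - a) * \<delta> * ((1 / z) ^ j)\<^sup>2 *
      (1 + \<delta>) ^ (2 * (n - t)) * (real t * (z + \<delta>) ^ (t - 1) * ((1 + z) / 2) ^ (2 * (n - t)))"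
  proof -
    have eq: "(1 / z) ^ (2 * j) = ((1 / z) ^ j)\<^sup>2" by (metis power_mult mult.commute)
    show ?thesis unfolding B_def eq power_mult_distrib by (simp only: mult_ac)
  qed
  also have "\<dots> \<le> real (b - a) * \<delta> * ((1 / z) ^ j)\<^sup>2 * exp 1 * (((1 + z) / 2) ^ (n - 1))\<^sup>2"
  proof (intro mult_mono mult_left_mono)
    \<comment> \<open>With \<open>2 * n\<close> levels, \<open>\<delta> * (2 * n) = 1\<close>, so
      the overlap of levels costs at most \<open>exp 1\<close> in total.\<close>
    have "(1 + \<delta>) ^ (2 * (n - t)) \<le> exp \<delta> ^ (2 * (n - t))"
      using \<delta> by (intro power_mono) auto
    also have "\<dots> \<le> exp \<delta> ^ (2 * n)" using \<delta> by (intro power_increasing) auto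
    also have "\<dots> = exp 1" using \<open>n > 0\<close> by (simp add: \<delta>_def flip: exp_of_nat_mult)
    finally show "(1 + \<delta>) ^ (2 * (n - t)) \<le> exp 1" .
    \<comment> \<open>so a larger intersection never increases the bound\<close>
    have "real t * (z + \<delta>) ^ (t - 1) \<le> 2 ^ (t - 1) * (1 / 8) ^ (t - 1)"
    proof (intro mult_mono power_mono)
      have "t \<le> 2 ^ (t - 1)" using t(1) less_exp[of "t - 1"] by linarith
      then show "real t \<le> 2 ^ (t - 1)" by (metis of_nat_le_iff of_nat_numeral of_nat_power)
    qed (use z \<delta> in \<open>auto simp: \<delta>_def\<close>)
    also have "\<dots> = ((1 / 2)\<^sup>2) ^ (t - 1)" by (simp add: power2_eq_square flip: power_mult_distrib)
    also have "\<dots> \<le> (((1 + z) / 2)\<^sup>2) ^ (t - 1)" using z by (intro power_mono) auto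
    finally have "real t * (z + \<delta>) ^ (t - 1) * ((1 + z) / 2) ^ (2 * (n - t))
        \<le> (((1 + z) / 2)\<^sup>2) ^ (t - 1) * ((1 + z) / 2) ^ (2 * (n - t))"
      using z by (intro mult_right_mono) auto
    also have "\<dots> = ((1 + z) / 2) ^ (2 * (t - 1) + 2 * (n - t))"
      by (simp add: power_add power_mult)
    also have "2 * (t - 1) + 2 * (n - t) = (n - 1) * 2" using t by simp
    finally show "real t * (z + \<delta>) ^ (t - 1) * ((1 + z) / 2) ^ (2 * (n - t)) \<le> (((1 + z) / 2) ^ (n - 1))\<^sup>2"
      by (simp add: power_mult)
  qed (use z \<delta> in auto)
  also have "\<dots> = exp 1 * (real (b - a) / real (2 * n)) * ((1 / z) ^ j * ((1 + z) / 2) ^ (n - 1))\<^sup>2"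
    by (simp add: \<delta>_def power_mult_distrib)
  finally show ?thesis .
qed

text \<open>With \<open>p = m / n\<close>, the mean is \<open>(1 + z) / 2\<close> times
  \<open>1 - p * (1 - z) / (1 + z)\<close>. Since \<open>(1 - z) / (1 + z) \<ge> 1 - 2 * z\<close>,
  the shift off the middle gains \<open>exp (- m)\<close> up to a factor
  \<open>exp (2 * m * z)\<close>.\<close>

lemma power_shifted_mean_le:
  fixes z :: real and n m :: nat
  assumes "n > 0" "m \<le> n" "0 < z" "z \<le> 1"
  shows "((real (n - m) + real (n + m) * z) / real (2 * n)) ^ n
    \<le> ((1 + z) / 2) ^ (n - 1) * (exp (- real m) * exp (2 * (real m * z)))"
proof -
  define p where "p = real m / real n"
  define y where "y = p * (1 - 2 * z)"
  have "(1 - 2 * z) * (1 + z) \<le> 1 - z" using assms by (simp add: algebra_simps)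
  then have "p * ((1 - 2 * z) * (1 + z)) \<le> p * (1 - z)"
    by (intro mult_left_mono) (auto simp: p_def)
  then have "(1 + z) - p * (1 - z) \<le> (1 + z) * (1 - y)"
    unfolding y_def by (simp add: algebra_simps)
  also have "\<dots> \<le> (1 + z) * exp (- y)"
    using assms exp_ge_add_one_self[of "- y"] by (intro mult_left_mono) auto
  finally have "(1 + z) - p * (1 - z) \<le> (1 + z) * exp (- y)" .
  moreover have "(real (n - m) + real (n + m) * z) / real (2 * n) = ((1 + z) - p * (1 - z)) / 2"
    using assms by (simp add: p_def of_nat_diff field_simps)
  ultimately have "(real (n - m) + real (n + m) * z) / real (2 * n) \<le> (1 + z) / 2 * exp (- y)"
    by simp
  then have "((real (n - m) + real (n + m) * z) / real (2 * n)) ^ n \<le> ((1 + z) / 2 * exp (- y)) ^ n"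
    using assms by (intro power_mono) auto
  also have "\<dots> = ((1 + z) / 2) ^ n * exp (- (real n * y))"
    by (simp only: power_mult_distrib exp_of_nat_mult[symmetric] mult_minus_right)
  also have "real n * y = real m - 2 * (real m * z)"
    using assms by (simp add: y_def p_def algebra_simps)
  \<comment> \<open>One factor \<open>(1 + z) / 2 \<le> 1\<close> is given away so that the exponent
    \<open>n - 1\<close> agrees with that of the conflict bound.\<close>
  also have "((1 + z) / 2) ^ n * exp (- (real m - 2 * (real m * z)))
      \<le> ((1 + z) / 2) ^ (n - 1) * exp (- (real m - 2 * (real m * z)))"
    using assms by (intro mult_right_mono power_decreasing) auto
  finally show ?thesis by (simp flip: exp_add)
qed

section \<open>Colouring by weights\<close>

text \<open>The deterministic core: an edge \<open>f\<close> with fewer than \<open>k\<close>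
  non-red vertices has a lowest red vertex \<open>v\<close>, made red by some \<open>e\<close>. Its
  level is not below \<open>a\<close> by \<open>left\<close> for \<open>e\<close>, not at least
  \<open>b\<close> by \<open>right\<close> for \<open>f\<close>, and not between by
  \<open>mid\<close>.\<close>

lemma property_B_if_no_conflict:
  fixes w :: "'v \<Rightarrow> nat"
  assumes "finite V" and E: "E \<subseteq> Pow V" "\<And>e. e \<in> E \<Longrightarrow> card e = n" and n: "2 * k \<le> n" "0 < k"
    and left: "\<And>e. e \<in> E \<Longrightarrow> k \<le> card {u \<in> e. a \<le> w u}"
    and right: "\<And>e. e \<in> E \<Longrightarrow> k \<le> card {u \<in> e. w u < b}"
    and mid: "\<And>e f v. \<lbrakk>e \<in> E; f \<in> E; e \<noteq> f; v \<in> e \<inter> f; a \<le> w v; w v < b;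
      card {u \<in> e. w v < w u} < k\<rbrakk> \<Longrightarrow> k \<le> card {u \<in> f. w u < w v}"
  shows "property_B k V E"
proof -
  obtain idx :: "'v \<Rightarrow> nat" and N where idx: "idx ` V = {i. i < N}" "inj_on idx V"
    using finite_imp_inj_to_nat_seg[OF \<open>finite V\<close>] by blast
  \<comment> \<open>ties must be broken: otherwise \<open>e = f\<close> below would not be contradictory\<close>
  define key where "key v = w v * N + idx v" for v
  have key_less: "key u < key v" if "w u < w v" "u \<in> V" for u v
  proof -
    have "idx u < N" using idx that by auto
    moreover have "w u * N + N \<le> w v * N"
      using that mult_le_mono1[of "Suc (w u)" "w v" N] by simp
    ultimately show ?thesis unfolding key_def by linarith
  qed
  have key_eq: "u = v" if "key u = key v" "u \<in> V" "v \<in> V" for u v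
  proof -
    have "w u = w v" using key_less that by (metis less_irrefl nat_neq_iff)
    then show ?thesis using that idx by (auto simp: key_def dest: inj_onD)
  qed
  define red where "red v \<longleftrightarrow> (\<exists>e\<in>E. v \<in> e \<and> card {u \<in> e. key v < key u} < k)" for v
  have fin: "finite e" if "e \<in> E" for e
    using that E \<open>finite V\<close> by (auto intro: finite_subset)
  have many_red: "k \<le> card {v \<in> e. red v}" if e: "e \<in> E" for e
  proof (rule ccontr)
    assume less: "\<not> k \<le> card {v \<in> e. red v}"
    \<comment> \<open>The highest non-red vertex of \<open>e\<close> has only red vertices of
      \<open>e\<close> above it, fewer than \<open>k\<close> of them, and so would itself be
      red.\<close>
    define X where "X = {v \<in> e. \<not> red v}"
    have "finite X" using fin[OF e] by (simp add: X_def)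
    have "{v \<in> e. red v} \<noteq> e" using less E(2)[OF e] n by auto
    then have "X \<noteq> {}" by (auto simp: X_def)
    then have "Max (key ` X) \<in> key ` X" using \<open>finite X\<close> by simp
    then obtain v where v: "v \<in> X" "key v = Max (key ` X)" by auto
    then have v_max: "key u \<le> key v" if "u \<in> X" for u using that \<open>finite X\<close> by simp
    have "{u \<in> e. key v < key u} \<subseteq> {v \<in> e. red v}"
      using v_max by (force simp: X_def)
    then have "card {u \<in> e. key v < key u} \<le> card {v \<in> e. red v}"
      using fin[OF e] by (intro card_mono) auto
    then have "card {u \<in> e. key v < key u} < k" using less by linarith
    then have "red v" unfolding red_def using e v(1) by (auto simp: X_def)
    then show False using v(1) by (simp add: X_def)
  qed
  have many_blue: "k \<le> card {v \<in> f. \<not> red v}" if f: "f \<in> E" for f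
  proof (rule ccontr)
    assume less: "\<not> k \<le> card {v \<in> f. \<not> red v}"
    define X where "X = {v \<in> f. red v}"
    have "finite X" using fin[OF f] by (simp add: X_def)
    have "{v \<in> f. \<not> red v} \<noteq> f" using less E(2)[OF f] n by auto
    then have "X \<noteq> {}" by (auto simp: X_def)
    then have "Min (key ` X) \<in> key ` X" using \<open>finite X\<close> by simp
    then obtain v where v: "v \<in> X" "key v = Min (key ` X)" by auto
    then have v_min: "key v \<le> key u" if "u \<in> X" for u using that \<open>finite X\<close> by simp
    have "{u \<in> f. key u < key v} \<subseteq> {v \<in> f. \<not> red v}"
      using v_min by (force simp: X_def)
    then have "card {u \<in> f. key u < key v} \<le> card {v \<in> f. \<not> red v}"
      using fin[OF f] by (intro card_mono) auto
    then have below: "card {u \<in> f. key u < key v} < k" using less by simp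
    obtain e where e: "e \<in> E" "v \<in> e" and above: "card {u \<in> e. key v < key u} < k"
      using v(1) by (auto simp: X_def red_def)
    have "v \<in> f" using v(1) by (simp add: X_def)
    have sub: "e \<subseteq> V" "f \<subseteq> V" using E e f by auto
    have "e \<noteq> f"
    proof
      assume "e = f"
      \<comment> \<open>Every other vertex is strictly above or below \<open>v\<close>, so
        \<open>n \<le> 1 + 2 * (k - 1)\<close>, against \<open>2 * k \<le> n\<close>.\<close>
      have "f \<subseteq> insert v ({u \<in> f. key u < key v} \<union> {u \<in> f. key v < key u})"
        using key_eq \<open>v \<in> f\<close> sub by (auto dest: linorder_neqE_nat)
      then have "card f \<le> card (insert v ({u \<in> f. key u < key v} \<union> {u \<in> f. key v < key u}))"
        using fin[OF f] by (intro card_mono) auto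
      also have "\<dots> \<le> Suc (card ({u \<in> f. key u < key v} \<union> {u \<in> f. key v < key u}))"
        by (rule card_insert_le_m1) auto
      also have "\<dots> \<le> Suc (card {u \<in> f. key u < key v} + card {u \<in> f. key v < key u})"
        using card_Un_le by auto
      finally show False using E(2)[OF f] n below above[unfolded \<open>e = f\<close>] by linarith
    qed
    \<comment> \<open>A strict inequality of weights implies one of keys, so counts by weight
      inherit \<open>above\<close> and \<open>below\<close>.\<close>
    have above': "card {u \<in> e. P u} < k" if "\<And>u. u \<in> e \<Longrightarrow> P u \<Longrightarrow> w v < w u" for P
      using that above fin[OF e(1)] key_less[of v] \<open>v \<in> f\<close> sub
      by (intro le_less_trans[OF card_mono above]) auto
    have below': "card {u \<in> f. P u} < k" if "\<And>u. u \<in> f \<Longrightarrow> P u \<Longrightarrow> w u < w v" for P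
      using that below fin[OF f] key_less[of _ v] sub
      by (intro le_less_trans[OF card_mono below]) auto
    consider "w v < a" | "b \<le> w v" | "a \<le> w v" "w v < b" by linarith
    then show False
    proof cases
      case 1
      then show False using left[OF e(1)] above'[of "\<lambda>u. a \<le> w u"] by simp
    next
      case 2
      then show False using right[OF f] below'[of "\<lambda>u. w u < b"] by simp
    next
      case 3
      then show False
        using mid[OF e(1) f \<open>e \<noteq> f\<close>, of v] e \<open>v \<in> f\<close> above'[of "\<lambda>u. w v < w u"]
          below'[of "\<lambda>u. w u < w v"] by simp
    qed
  qed
  show ?thesis
    unfolding property_B_def
  proof (intro exI[of _ red] ballI allI)
    fix e b assume "e \<in> E"
    then show "k \<le> card {v \<in> e. red v = b}"
      using many_red many_blue by (cases b) auto
  qed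
qed

lemma finite_edges: "hypergraph V E \<Longrightarrow> finite E"
  unfolding hypergraph_def by (meson finite_Pow_iff finite_subset)

section \<open>Application of the local lemma\<close>

text \<open>\<open>G\<close> is the Chernoff factor of one edge. The bound for \<open>few\<close> is
  linear in \<open>G\<close> with the gain \<open>exp (- m)\<close>, that for
  \<open>conflict\<close> quadratic with the fraction \<open>m / n\<close> of middle levels.
  \<open>le\<close> is the local lemma condition, its factor \<open>4 * (D + 1)\<close> coming from
  the count of neighbouring pairs.\<close>

lemma property_B_if_local_conditions:
  fixes V :: "'v set" and E :: "'v set set" and n k m :: nat and z D G :: real
  assumes H: "uniform_hypergraph n V E" and "n > 0" "0 < k" "2 * k \<le> n" "m \<le> n"
    and D: "\<And>e. e \<in> E \<Longrightarrow> real (card (intersecting_edges E e)) \<le> D"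
    and z: "0 < z" "z + 1 / real (2 * n) \<le> 1 / 8"
  defines "G \<equiv> (1 / z) ^ (k - 1) * ((1 + z) / 2) ^ (n - 1)"
  assumes le: "4 * ((D + 1) * (2 * (G * (exp (- real m) * exp (2 * (real m * z))))
      + D * (exp 1 * (real m / real n) * G\<^sup>2))) \<le> 1 / 4"
  shows "property_B k V E"
proof -
  define j where "j = k - 1"
  have k: "k = Suc j" using \<open>0 < k\<close> by (simp add: j_def)
  have V: "finite V" and E: "E \<subseteq> Pow V" and card: "\<And>e. e \<in> E \<Longrightarrow> card e = n"
    using H by (auto simp: uniform_hypergraph_def hypergraph_def)
  have "finite E" using H finite_edges by (auto simp: uniform_hypergraph_def)
  have ne: "e \<noteq> {}" if "e \<in> E" for e using card[OF that] \<open>n > 0\<close> by auto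
  have z1: "z \<le> 1"
  proof -
    have "0 \<le> 1 / real (2 * n)" by simp
    then show ?thesis using z(2) by linarith
  qed
  define a b where "a = n - m" and "b = n + m"
  \<comment> \<open>The pair \<open>(e, e)\<close> encodes the event of the single edge \<open>e\<close>.\<close>
  define few where "few e = {w :: 'v \<Rightarrow> nat. card {u \<in> e. w u \<in> {a..}} \<le> j} \<union>
    {w. card {u \<in> e. w u \<in> {..<b}} \<le> j}" for e
  define conflict where "conflict e f = {w :: 'v \<Rightarrow> nat. \<exists>v\<in>e \<inter> f. a \<le> w v \<and> w v < b \<and>
    card {u \<in> e. w v < w u} \<le> j \<and> card {u \<in> f. w u < w v} \<le> j}" for e f
  define A where "A = (\<lambda>(e, f). if e = f then few e else conflict e f)"
  define I where "I = {(e, f). e \<in> E \<and> f \<in> E \<and> e \<inter> f \<noteq> {}}"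
  define P where "P = pmf_of_set (PiE V (\<lambda>_. {..<2 * n}))"
  define \<alpha> where "\<alpha> = 2 * (G * (exp (- real m) * exp (2 * (real m * z))))"
  define \<beta> where "\<beta> = exp 1 * (real m / real n) * G\<^sup>2"
  have "0 \<le> G" using z by (simp add: G_def)
  have few_le: "measure_pmf.prob P (few e) \<le> \<alpha>" if e: "e \<in> E" for e
  proof -
    \<comment> \<open>Each half of \<open>few e\<close> concerns a set of \<open>n + m\<close> of
      the \<open>2 * n\<close> levels, so one bound serves both.\<close>
    have "measure_pmf.prob P {w. card {u \<in> e. w u \<in> B} \<le> j} \<le> \<alpha> / 2"
      if B: "card ({..<2 * n} - B) = n - m" "card ({..<2 * n} \<inter> B) = n + m" for B
    proof -
      have "measure_pmf.prob P {w. card {u \<in> e. w u \<in> B} \<le> j} \<le>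
          (1 / z) ^ j * ((real (n - m) + real (n + m) * z) / real (2 * n)) ^ n"
        using prob_few_le[of V "{..<2 * n}" e z B j] V E e z z1 B card[OF e] \<open>n > 0\<close>
        by (auto simp: P_def lessThan_empty_iff)
      also have "\<dots> \<le> (1 / z) ^ j * (((1 + z) / 2) ^ (n - 1) * (exp (- real m) * exp (2 * (real m * z))))"
        using assms z1 by (intro mult_left_mono power_shifted_mean_le) auto
      finally show ?thesis by (simp add: \<alpha>_def G_def j_def)
    qed
    note half = this
    have "{..<2 * n} - {a..} = {..<n - m}" "{..<2 * n} \<inter> {a..} = {n - m..<2 * n}"
      "{..<2 * n} - {..<b} = {n + m..<2 * n}" "{..<2 * n} \<inter> {..<b} = {..<n + m}"
      using \<open>m \<le> n\<close> by (auto simp: a_def b_def)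
    then have "measure_pmf.prob P {w. card {u \<in> e. w u \<in> {a..}} \<le> j} \<le> \<alpha> / 2"
      and "measure_pmf.prob P {w. card {u \<in> e. w u \<in> {..<b}} \<le> j} \<le> \<alpha> / 2"
      using \<open>m \<le> n\<close> half[of "{a..}"] half[of "{..<b}"] by simp_all
    then show ?thesis
      unfolding few_def by (intro order.trans[OF measure_Un_le]) auto
  qed
  have conflict_le: "measure_pmf.prob P (conflict e f) \<le> \<beta>"
    if "e \<in> E" "f \<in> E" "e \<inter> f \<noteq> {}" for e f
  proof -
    have "measure_pmf.prob P (conflict e f) \<le> exp 1 * (real (b - a) / real (2 * n)) * G\<^sup>2"
      unfolding conflict_def P_def G_def j_def[symmetric] using that assms V E card
      by (intro prob_conflict_le) (auto simp: a_def b_def)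
    also have "real (b - a) / real (2 * n) = real m / real n"
      using \<open>m \<le> n\<close> by (simp add: a_def b_def)
    finally show ?thesis by (simp add: \<beta>_def)
  qed
  have "\<exists>w \<in> PiE V (\<lambda>_. {..<2 * n}). \<forall>i\<in>I. w \<notin> A i"
  proof (rule lovasz_local_PiE[where S = "\<lambda>(e, f). e \<union> f"])
    show "finite I"
      by (rule finite_subset[of _ "E \<times> E"]) (use \<open>finite E\<close> in \<open>auto simp: I_def\<close>)
    fix i assume i: "i \<in> I"
    then obtain e f where ef: "i = (e, f)" "e \<in> E" "f \<in> E" "e \<inter> f \<noteq> {}" by (auto simp: I_def)
    have "w' \<in> A i" if eq: "\<forall>v\<in>e \<union> f. w v = w' v" and w: "w \<in> A i" for w w'
    proof -
      have 1: "{u \<in> e. Q (w' u)} = {u \<in> e. Q (w u)}" "{u \<in> f. Q (w' u)} = {u \<in> f. Q (w u)}" for Q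
        using eq by auto
      show ?thesis
      proof (cases "e = f")
        case True
        then show ?thesis using w by (simp add: A_def ef few_def 1[of "\<lambda>x. a \<le> x"] 1[of "\<lambda>x. x < b"])
      next
        case False
        then obtain v where v: "v \<in> e \<inter> f" "a \<le> w v" "w v < b"
            "card {u \<in> e. w v < w u} \<le> j" "card {u \<in> f. w u < w v} \<le> j"
          using w by (auto simp: A_def ef conflict_def)
        have "w v = w' v" using eq v(1) by auto
        then have "card {u \<in> e. w' v < w' u} \<le> j" "card {u \<in> f. w' u < w' v} \<le> j"
          using v(4,5) 1(1)[of "\<lambda>x. w' v < x"] 1(2)[of "\<lambda>x. x < w' v"] by simp_all
        then have "w' \<in> conflict e f"
          unfolding conflict_def using v(1-3) \<open>w v = w' v\<close> by (intro CollectI bexI[of _ v]) auto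
        then show ?thesis using False by (simp add: A_def ef)
      qed
    qed
    then show "determined_by (A i) (case i of (e, f) \<Rightarrow> e \<union> f)"
      unfolding determined_by_def by (auto simp: ef)
    show "(case i of (e, f) \<Rightarrow> e \<union> f) \<noteq> {}" using ne ef by auto
    have "(\<Sum>i'\<in>{(g, h) \<in> I. (e \<union> f) \<inter> (g \<union> h) \<noteq> {}}. measure_pmf.prob P (A i'))
        \<le> 4 * ((D + 1) * (\<alpha> + D * \<beta>))"
      unfolding I_def using \<open>finite E\<close> ef D few_le conflict_le \<open>0 \<le> G\<close>
      by (intro sum_neighbouring_pairs_le) (auto simp: A_def \<alpha>_def \<beta>_def)
    also have "\<dots> \<le> 1 / 4" using le by (simp only: \<alpha>_def \<beta>_def)
    finally show "(\<Sum>i'\<in>{i' \<in> I. (case i of (e, f) \<Rightarrow> e \<union> f) \<inter> (case i' of (e, f) \<Rightarrow> e \<union> f) \<noteq> {}}.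
        measure_pmf.prob (pmf_of_set (PiE V (\<lambda>_. {..<2 * n}))) (A i')) \<le> 1 / 4"
      by (simp add: ef P_def case_prod_unfold)
  qed (use V \<open>n > 0\<close> in \<open>auto simp: lessThan_empty_iff\<close>)
  then obtain w where w: "\<And>i. i \<in> I \<Longrightarrow> w \<notin> A i" by auto
  have few: "w \<notin> few e" if "e \<in> E" for e
    using w[of "(e, e)"] that ne by (auto simp: I_def A_def)
  have conflict: "w \<notin> conflict e f" if "e \<in> E" "f \<in> E" "e \<noteq> f" "v \<in> e \<inter> f" for e f v
    using w[of "(e, f)"] that by (auto simp: I_def A_def)
  show ?thesis
  proof (rule property_B_if_no_conflict[OF V E card \<open>2 * k \<le> n\<close> \<open>0 < k\<close>])
    fix e assume "e \<in> E"
    then show "k \<le> card {u \<in> e. a \<le> w u}" "k \<le> card {u \<in> e. w u < b}"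
      using few[of e] by (auto simp: few_def k)
  next
    fix e f v
    assume "e \<in> E" "f \<in> E" "e \<noteq> f" "v \<in> e \<inter> f" "a \<le> w v" "w v < b" "card {u \<in> e. w v < w u} < k"
    then show "k \<le> card {u \<in> f. w u < w v}"
      using conflict[of e f v] unfolding conflict_def k by (auto simp: not_less_eq_eq)
  qed
qed

section \<open>Choice of parameters and numerical estimates\<close>

theorem theorem6:
  fixes n k :: nat and D :: real and V :: "'v set" and E :: "'v set set"
  assumes "n \<ge> 30" and "k \<ge> 2"
    and "real k \<le> sqrt (real n / ln (real n))"
    and "uniform_hypergraph n V E"
    and "\<forall>e\<in>E. real (card (intersecting_edges E e)) \<le> D"
    and "D \<le> 5 / (3 * exp 26) * sqrt (real n / (real k * ln (real n)))
               * (2 ^ (n - 1) / real ((n - 1) choose (k - 1))) - 1"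
  shows "property_B k V E"
\<comment> \<open>It takes an actual edge to force \<open>D\<close> to be nonnegative.\<close>
proof (cases "E = {}")
  case True
  then show ?thesis by (simp add: property_B_def)
next
  case False
  then obtain e where "e \<in> E" by auto
  then have D0: "0 \<le> D" using assms(5) by (meson of_nat_0_le_iff order_trans)
  define L where "L = ln (real n)"
  define x where "x = real n"
  define j where "j = k - 1"
  have j: "real j = real k - 1" "1 \<le> j" using assms(2) by (auto simp: j_def of_nat_diff)
  have x: "x \<ge> 30" using assms(1) by (simp add: x_def)
  have k2: "real k \<ge> 2" using assms(2) by simp
  have "exp 2 = (exp 1 :: real) ^ 2" by (simp flip: exp_of_nat_mult)
  also have "\<dots> \<le> 3 ^ 2" using exp_le by (intro power_mono) auto
  also have "\<dots> \<le> x" using x by simp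
  finally have L2: "L \<ge> 2" using x by (simp add: L_def x_def ln_ge_iff)
  have "(real k)\<^sup>2 \<le> (sqrt (x / L))\<^sup>2"
    using assms(3) by (intro power_mono) (auto simp: x_def L_def)
  then have kL: "(real k)\<^sup>2 * L \<le> x" using x L2 by (simp add: field_simps)
  have "(real k)\<^sup>2 * 2 \<le> (real k)\<^sup>2 * L" using L2 by (intro mult_left_mono) auto
  then have kk: "2 * (real k)\<^sup>2 \<le> x" using kL by simp
  have "real k * 2 \<le> real k * real k" using k2 by (intro mult_left_mono) auto
  then have "real (2 * k) \<le> x" using kk by (simp add: power2_eq_square)
  then have "2 * k \<le> n" by (simp add: x_def)
  have Lx: "L \<le> x - 1" using x by (auto simp: L_def x_def intro: ln_le_minus_one)
  \<comment> \<open>large enough for \<open>exp (- m) \<le> 1 / sqrt n\<close>, yet of order \<open>ln n\<close>\<close>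
  define m where "m = nat \<lceil>L / 2\<rceil>"
  have m: "L / 2 \<le> real m" "real m \<le> L"
    unfolding m_def using L2 by linarith+
  have "m \<le> n"
  proof -
    have "real m \<le> real n" using m Lx by (simp add: x_def)
    then show ?thesis by simp
  qed
  \<comment> \<open>nearly the minimiser of \<open>z powr - j * (1 + z) ^ (n - 1)\<close>; the loss against the binomial coefficient is only of order \<open>sqrt j\<close>\<close>
  define z where "z = real j / real (n - 1)"
  have n1: "real (n - 1) = x - 1" using assms(1) by (simp add: x_def of_nat_diff)
  have z0: "0 < z" using j assms(1) by (simp add: z_def)
  have z8: "z + 1 / real (2 * n) \<le> 1 / 8"
  proof -
    \<comment> \<open>A tangent linearises \<open>k\<close>:
      \<open>8 * k \<le> k\<^sup>2 + 16 \<le> x / 2 + 16\<close>.\<close>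
    have "0 \<le> (real k - 4)\<^sup>2" by simp
    then have "real j \<le> (x + 16) / 16"
      using kk j by (simp add: power2_eq_square algebra_simps)
    then have "z \<le> (x + 16) / 16 / (x - 1)"
      using x unfolding z_def n1 by (intro divide_right_mono) auto
    \<comment> \<open>This amounts to \<open>x \<ge> 88 / 3\<close>, which \<open>n \<ge> 30\<close>
      supplies; \<open>1 / 10 + 1 / 60\<close> then stays below \<open>1 / 8\<close>.\<close>
    also have "\<dots> \<le> 1 / 10" using x by (simp add: field_simps)
    finally have "z \<le> 1 / 10" .
    moreover have "1 / real (2 * n) \<le> 1 / 60" using x by (simp add: x_def field_simps)
    ultimately show ?thesis by linarith
  qed
  \<comment> \<open>Keeps the correction \<open>exp (2 * (m * z))\<close> below the constant
    \<open>exp 2\<close>.\<close>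
  have mz: "real m * z \<le> 1"
  proof -
    have "real m * real j \<le> L * (real k - 1)" using m j by (intro mult_mono) auto
    also have "\<dots> \<le> x - 1"
    proof -
      have "real k * L \<le> (real k)\<^sup>2 * L"
        using k2 L2 by (intro mult_right_mono) (auto simp: power2_eq_square)
      moreover have "L * (real k - 1) = real k * L - L" by (simp add: algebra_simps)
      ultimately show ?thesis using kL L2 by linarith
    qed
    finally show ?thesis using x unfolding z_def n1 by (simp add: field_simps)
  qed
  define q where "q = real ((n - 1) choose (k - 1)) / 2 ^ (n - 1)"
  have q: "q > 0" using \<open>2 * k \<le> n\<close> by (simp add: q_def)
  define G where "G = (1 / z) ^ (k - 1) * ((1 + z) / 2) ^ (n - 1)"
  have G0: "0 \<le> G" using z0 by (simp add: G_def)
  have G: "G \<le> 2 * exp 1 * sqrt (real j) * q"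
  proof -
    have "real (j * (j - 1)) \<le> real (n - 1)"
    proof -
      have "real (j * (j - 1)) = (real k - 1) * (real k - 2)"
        using j by (simp add: of_nat_diff)
      also have "\<dots> = (real k)\<^sup>2 - 3 * real k + 2" by (simp add: power2_eq_square algebra_simps)
      also have "\<dots> \<le> x - 1" using kk k2 zero_le_power2[of "real k"] by linarith
      finally show ?thesis by (simp only: n1)
    qed
    then have "j * (j - 1) \<le> n - 1" by (simp only: of_nat_le_iff)
    then have "(real (n - 1) / real j) ^ j * (1 + real j / real (n - 1)) ^ (n - 1)
        \<le> 2 * exp 1 * sqrt (real j) * real ((n - 1) choose j)"
      using j \<open>2 * k \<le> n\<close> by (intro binomial_ge_Chernoff) (auto simp: j_def)
    moreover have "G = (real (n - 1) / real j) ^ j * (1 + real j / real (n - 1)) ^ (n - 1) / 2 ^ (n - 1)"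
      by (simp add: G_def z_def j_def power_divide)
    ultimately show ?thesis by (simp add: q_def j_def divide_right_mono)
  qed
  define c :: real where "c = 5 / (3 * exp 26)"
  define r where "r = sqrt (x / (real k * L))"
  have "c > 0" by (simp add: c_def)
  have r0: "r \<ge> 0" using x L2 by (simp add: r_def)
  have Dq: "(D + 1) * q \<le> c * r"
  proof -
    have "D + 1 \<le> c * r / q"
      using assms(6) by (simp add: c_def r_def q_def x_def L_def)
    then show ?thesis using q by (simp add: field_simps)
  qed
  have few: "(D + 1) * (2 * (G * (exp (- real m) * exp (2 * (real m * z))))) \<le> 4 * exp 3 * c"
  proof -
    have em: "exp (- real m) \<le> 1 / sqrt x"
    proof -
      have "exp (- real m) \<le> exp (- (L / 2))" using m by simp
      also have "\<dots> = 1 / exp (L / 2)" by (simp add: exp_minus field_simps)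
      also have "exp (L / 2) = sqrt x"
      proof (rule sym, rule real_sqrt_unique)
        show "(exp (L / 2))\<^sup>2 = x" using x by (simp add: L_def x_def flip: exp_double)
      qed simp
      finally show ?thesis .
    qed
    \<comment> \<open>The gain \<open>1 / sqrt x\<close> from \<open>exp (- m)\<close> cancels the
      \<open>sqrt x\<close> in \<open>r\<close>, whose denominator \<open>sqrt (k * L)\<close>
      absorbs the Chernoff loss \<open>sqrt j\<close>.\<close>
    have "r * sqrt (real j) / sqrt x \<le> 1"
    proof -
      have "real j * 1 \<le> real k * L" using j k2 L2 by (intro mult_mono) auto
      then have "x / (real k * L) * real j / x \<le> 1" using x k2 L2 by (simp add: field_simps)
      then have "sqrt (x / (real k * L) * real j / x) \<le> 1" by simp
      then show ?thesis by (simp only: r_def real_sqrt_mult real_sqrt_divide)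
    qed
    then have rj: "r * sqrt (real j) * (1 / sqrt x) \<le> 1" by simp
    have "G * (exp (- real m) * exp (2 * (real m * z))) \<le>
        (2 * exp 1 * sqrt (real j) * q) * ((1 / sqrt x) * exp 2)"
      using G G0 em mz q x by (intro mult_mono) auto
    then have "(D + 1) * (2 * (G * (exp (- real m) * exp (2 * (real m * z))))) \<le>
        (D + 1) * (2 * ((2 * exp 1 * sqrt (real j) * q) * ((1 / sqrt x) * exp 2)))"
      using D0 by (intro mult_left_mono) auto
    also have "\<dots> = 4 * (exp 1 * exp 2) * (sqrt (real j) * (1 / sqrt x)) * ((D + 1) * q)"
      by (simp add: mult_ac)
    also have "\<dots> \<le> 4 * (exp 1 * exp 2) * (sqrt (real j) * (1 / sqrt x)) * (c * r)"
      using Dq x by (intro mult_left_mono) auto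
    also have "\<dots> = 4 * exp 3 * c * (r * sqrt (real j) * (1 / sqrt x))"
      by (simp add: mult_ac flip: exp_add)
    also have "\<dots> \<le> 4 * exp 3 * c * 1"
      using rj \<open>c > 0\<close> by (intro mult_left_mono) auto
    finally show ?thesis by simp
  qed
  have conflict: "(D + 1) * (D * (exp 1 * (real m / real n) * G\<^sup>2)) \<le> 4 * exp 3 * c\<^sup>2"
  proof -
    \<comment> \<open>Here the logarithm in the bound on \<open>D\<close> is spent: the
      \<open>1 / (k * L)\<close> in \<open>r\<^sup>2\<close> offsets \<open>m \<le> L\<close> and
      the \<open>j\<close> from the squared Chernoff loss.\<close>
    have "r\<^sup>2 * (real m / x) * real j \<le> 1"
    proof -
      have "real m * real j \<le> L * real k" using m j L2 by (intro mult_mono) auto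
      moreover have "r\<^sup>2 = x / (real k * L)" using x k2 L2 by (simp add: r_def)
      then have "r\<^sup>2 * (real m / x) * real j = real m * real j / (L * real k)"
        using x by simp
      moreover have "0 < L * real k" using k2 L2 by (intro mult_pos_pos) auto
      ultimately show ?thesis by simp
    qed
    have "(D + 1) * (D * (exp 1 * (real m / real n) * G\<^sup>2)) \<le>
        (D + 1) * ((D + 1) * (exp 1 * (real m / x) * (2 * exp 1 * sqrt (real j) * q)\<^sup>2))"
      using D0 G G0 x unfolding x_def by (intro mult_mono mult_left_mono power_mono) auto
    also have "\<dots> = 4 * (exp 1 * exp 1 * exp 1) * (real m / x) * real j * ((D + 1) * q)\<^sup>2"
      by (simp add: power_mult_distrib) (simp add: power2_eq_square mult_ac)
    also have "\<dots> \<le> 4 * (exp 1 * exp 1 * exp 1) * (real m / x) * real j * (c * r)\<^sup>2"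
      using Dq D0 q x by (intro mult_left_mono power_mono) auto
    also have "\<dots> = 4 * exp 3 * c\<^sup>2 * (r\<^sup>2 * (real m / x) * real j)"
      by (simp add: power_mult_distrib mult_ac flip: exp_add)
    also have "\<dots> \<le> 4 * exp 3 * c\<^sup>2 * 1"
      by (intro mult_left_mono) (fact, simp)
    finally show ?thesis by simp
  qed
  \<comment> \<open>As \<open>c\<^sup>2 \<le> c\<close>, both contributions are at most
    \<open>4 * exp 3 * c\<close>; the local lemma then asks for
    \<open>4 * (4 + 4) * exp 3 * c \<le> 1 / 4\<close>.\<close>
  have c: "128 * (exp 3 * c) \<le> 1" "c \<le> 1"
  proof -
    have "(2::real) ^ 23 \<le> exp 1 ^ 23"
      using exp_ge_add_one_self[of "1::real"] by (intro power_mono) auto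
    then have "(2::real) ^ 23 \<le> exp 23" by (simp flip: exp_of_nat_mult)
    moreover have "exp 26 = exp 3 * (exp 23 :: real)" by (simp flip: exp_add)
    ultimately show *: "128 * (exp 3 * c) \<le> 1" by (simp add: c_def field_simps)
    have "1 * c \<le> exp 3 * c" using \<open>c > 0\<close> by (intro mult_right_mono) auto
    then show "c \<le> 1" using * \<open>c > 0\<close> by linarith
  qed
  have "exp 3 * c\<^sup>2 \<le> exp 3 * c"
    using c \<open>c > 0\<close> mult_left_mono[of c 1 c] by (simp add: power2_eq_square)
  then have "4 * ((D + 1) * (2 * (G * (exp (- real m) * exp (2 * (real m * z))))
      + D * (exp 1 * (real m / real n) * G\<^sup>2))) \<le> 1 / 4"
    using few conflict c unfolding distrib_left by linarith
  then show ?thesis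
    using assms(1,2,4,5) \<open>2 * k \<le> n\<close> \<open>m \<le> n\<close> z0 z8 unfolding G_def
    by (intro property_B_if_local_conditions[of n V E k m D z]) auto
qed

end
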